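(* Let $G$ be a graph on $n\geq 2$ vertices with minimum degree $\delta(G)\geq 10\ln(n)$, and let $b\geq 1$ be an integer. Then $$\gamma_{MB}(G,b)\leq \frac{10\,n\ln(n)}{b\,\delta(G)}.$$
   Context: The $b$-biased Maker-Breaker domination game on a finite graph $G$: Dominator and Staller alternately claim previously unclaimed vertices of $G$; in each of her turns Dominator claims up to $b$ vertices, in each of his turns Staller claims one vertex. A round consists of one turn of each player. Dominator wins if the set of vertices she claims contains a dominating set of $G$; otherwise Staller wins. $\gamma_{MB}(G,b)$ is the smallest number of rounds within which Dominator can guarantee to win when Dominator makes the first move (both players playing optimally), and $\gamma_{MB}(G,b)=\infty$ if Staller has a winning strategy.
   Formalization: The bound is replaced by the maximum of 1 and 10 n ln(n)/(b δ(G)), since at least one round is always needed and the stated bound falls below 1 for large b (for example the complete graph on 1024 vertices with b = 1024). *)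

theory Defs
  imports "HOL-Analysis.Analysis" "Graph_Theory.Pair_Digraph"
begin

text \<open>
  A finite simple graph is a \<open>pair_graph\<close>: a finite, symmetric, loop-free digraph without parallel
  arcs. Each edge \<open>uv\<close> is represented by the two arcs \<open>(u,v)\<close> and \<open>(v,u)\<close>, so the degree of a
  vertex is its out-degree.
\<close>

definition min_degree :: "'a pair_pre_digraph \<Rightarrow> nat" where
  "min_degree G = Min (out_degree (with_proj G) ` pverts G)"

definition dominating_set :: "'a pair_pre_digraph \<Rightarrow> 'a set \<Rightarrow> bool" where
  "dominating_set G S \<longleftrightarrow>
     S \<subseteq> pverts G \<and> (\<forall>v \<in> pverts G - S. \<exists>u \<in> S. (u, v) \<in> parcs G)"

definition contains_dominating_set :: "'a pair_pre_digraph \<Rightarrow> 'a set \<Rightarrow> bool" where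
  "contains_dominating_set G A \<longleftrightarrow> (\<exists>S \<subseteq> A. dominating_set G S)"

text \<open>
  \<open>dominator_wins_within G b k D S\<close>: from the position in which Dominator has claimed \<open>D\<close>, Staller
  has claimed \<open>S\<close> and Dominator is to move, Dominator can force a win within the next \<open>k\<close> rounds.
  In each round she claims a set \<open>X\<close> of at most \<open>b\<close> free vertices; if this does not already win,
  Staller claims a single free vertex \<open>v\<close>. If no free vertex is left for him, then the game
  is over and Dominator has lost. A round in which Dominator's turn completes a dominating
  set is counted.
\<close>

primrec dominator_wins_within ::
  "'a pair_pre_digraph \<Rightarrow> nat \<Rightarrow> nat \<Rightarrow> 'a set \<Rightarrow> 'a set \<Rightarrow> bool" where
  "dominator_wins_within G b 0 D S \<longleftrightarrow> contains_dominating_set G D"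
| "dominator_wins_within G b (Suc k) D S \<longleftrightarrow>
     (\<exists>X \<subseteq> pverts G - (D \<union> S). card X \<le> b \<and>
        (contains_dominating_set G (D \<union> X) \<or>
         pverts G - (D \<union> X \<union> S) \<noteq> {} \<and>
         (\<forall>v \<in> pverts G - (D \<union> X \<union> S). dominator_wins_within G b k (D \<union> X) (insert v S))))"

text \<open>
  The value is \<open>\<infinity>\<close> if Dominator cannot force a win in any number of rounds
  (\<open>Inf {} = \<infinity>\<close> in \<open>enat\<close>), which for this finite game means that Staller has a winning strategy.
\<close>

definition gamma_MB :: "'a pair_pre_digraph \<Rightarrow> nat \<Rightarrow> enat" where
  "gamma_MB G b = Inf {enat k | k. dominator_wins_within G b k {} {}}"

text \<open>
  At least one round is needed on a nonempty graph. Hence an upper bound for \<open>gamma_MB\<close> whose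
  value may be smaller than 1 (for large bias) can only be meant as \<open>max 1\<close> of that value.
\<close>

lemma gamma_MB_ge_1:
  assumes "pverts G \<noteq> {}"
  shows "1 \<le> gamma_MB G b"
  unfolding gamma_MB_def
proof (rule Inf_greatest)
  fix x assume "x \<in> {enat k | k. dominator_wins_within G b k {} {}}"
  then obtain k where k: "x = enat k" "dominator_wins_within G b k {} {}" by blast
  have "k \<noteq> 0"
    using k(2) assms by (auto simp: contains_dominating_set_def dominating_set_def)
  then show "1 \<le> x" using k(1) by (simp add: one_enat_def)
qed

end

(*
  Staller tries to claim a whole closed neighbourhood.  Give each vertex v that is not yet
  dominated the weight (3/2)^s, where s counts Staller's vertices in N[v], and let Phi be the total
  weight.  Dominator always claims a free vertex x for which the weight W(x) of the undominated
  vertices in N[x] is largest.  This removes W(x) from Phi, and a reply of Staller adds at most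
  W(x)/2.  Hence Phi never exceeds its initial value n, so (3/2)^s <= n holds throughout, and since
  the minimum degree d is at least 10 ln n, at least d/2 vertices of every undominated N[v] are
  free.  Averaging gives W(x) >= d Phi / (2n), so every claimed vertex shrinks Phi by the factor
  1 - d/(4n), even after Staller's reply.  After 5 n ln n / d claimed vertices Phi < 1, which means
  that nothing is left to dominate.
*)
theory Submission
  imports Defs
begin

section \<open>Weights and potential of the game of hitting all sets \<open>N v\<close>\<close>

locale hitting_game =
  fixes V :: "'a set" and N :: "'a \<Rightarrow> 'a set" and d :: nat
  assumes finite_V: "finite V"
    and N_subset: "v \<in> V \<Longrightarrow> N v \<subseteq> V"
    and card_N: "v \<in> V \<Longrightarrow> d \<le> card (N v)"
    and ln_le_d: "10 * ln (real (card V)) \<le> real d"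
    and V_nonempty: "V \<noteq> {}"
begin

definition unhit :: "'a set \<Rightarrow> 'a set" where
  "unhit D = {v \<in> V. N v \<inter> D = {}}"

definition weight :: "'a set \<Rightarrow> 'a \<Rightarrow> real" where
  "weight S v = (3/2) ^ card (N v \<inter> S)"

definition potential :: "'a set \<Rightarrow> 'a set \<Rightarrow> real" where
  "potential D S = (\<Sum>v\<in>unhit D. weight S v)"

text \<open>This is W(x) of the overview.\<close>

definition gain :: "'a set \<Rightarrow> 'a set \<Rightarrow> 'a \<Rightarrow> real" where
  "gain D S x = (\<Sum>v\<in>{v \<in> unhit D. x \<in> N v}. weight S v)"

lemma finite_unhit [simp]: "finite (unhit D)"
  using finite_V by (simp add: unhit_def)

lemma finite_N: "v \<in> V \<Longrightarrow> finite (N v)"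
  using N_subset finite_V finite_subset by blast

lemma unhit_subset: "unhit D \<subseteq> V"
  by (auto simp: unhit_def)

lemma unhit_antimono: "D \<subseteq> D' \<Longrightarrow> unhit D' \<subseteq> unhit D"
  by (auto simp: unhit_def)

lemma card_V_pos: "card V > 0"
  using finite_V V_nonempty by (simp add: card_gt_0_iff)

lemma weight_ge_1: "1 \<le> weight S v"
  by (simp add: weight_def)

lemma weight_nonneg: "0 \<le> weight S v"
  using weight_ge_1[of S v] by linarith

lemma potential_nonneg: "0 \<le> potential D S"
  by (simp add: potential_def weight_nonneg sum_nonneg)

lemma weight_le_potential: "v \<in> unhit D \<Longrightarrow> weight S v \<le> potential D S"
  unfolding potential_def by (rule member_le_sum) (auto simp: weight_nonneg)

text \<open>Every weight is at least 1, so one remaining unhit vertex already keeps the potential at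
  1 or more; a strict numerical bound therefore certifies a win.\<close>

lemma potential_less_1_iff: "potential D S < 1 \<longleftrightarrow> unhit D = {}"
proof
  assume "potential D S < 1"
  then show "unhit D = {}"
    using weight_le_potential weight_ge_1 by (metis equals0I leD order_trans)
qed (simp add: potential_def)

lemma potential_empty: "potential {} {} = card V"
  by (simp add: potential_def weight_def unhit_def)

lemma potential_insert_left: "potential (insert x D) S = potential D S - gain D S x"
proof -
  have "unhit D = unhit (insert x D) \<union> {v \<in> unhit D. x \<in> N v}"
    "unhit (insert x D) \<inter> {v \<in> unhit D. x \<in> N v} = {}"
    by (auto simp: unhit_def)
  then have "potential D S = potential (insert x D) S + gain D S x"
    unfolding potential_def gain_def
    using sum.union_disjoint[of "unhit (insert x D)" "{v \<in> unhit D. x \<in> N v}" "weight S"]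
    by simp
  then show ?thesis by simp
qed

text \<open>Since \<open>y\<close> is new to \<open>S\<close>, each unhit \<open>v\<close> with
  \<open>y\<close> in \<open>N v\<close> has its weight multiplied by 3/2, an increase by half of
  it.\<close>

lemma potential_insert_right:
  assumes "y \<notin> S"
  shows "potential D (insert y S) = potential D S + gain D S y / 2"
proof -
  have "weight (insert y S) v = weight S v + (if y \<in> N v then weight S v / 2 else 0)"
    if "v \<in> unhit D" for v
  proof -
    have "finite (N v \<inter> S)"
      using that unhit_subset finite_N by blast
    then show ?thesis
      using assms by (simp add: weight_def)
  qed
  then have "potential D (insert y S)
      = (\<Sum>v\<in>unhit D. weight S v + (if y \<in> N v then weight S v / 2 else 0))"
    by (simp add: potential_def)
  also have "\<dots> = potential D S + (\<Sum>v\<in>{v \<in> unhit D. y \<in> N v}. weight S v / 2)"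
    by (simp add: sum.distrib potential_def sum.inter_filter)
  finally show ?thesis
    by (simp add: gain_def sum_divide_distrib)
qed

lemma gain_nonneg: "0 \<le> gain D S x"
  by (simp add: gain_def weight_nonneg sum_nonneg)

lemma gain_antimono: "D \<subseteq> D' \<Longrightarrow> gain D' S x \<le> gain D S x"
  unfolding gain_def using unhit_antimono by (intro sum_mono2) (auto simp: weight_nonneg)

text \<open>Double counting of the pairs of \<open>x\<close> in \<open>F\<close> and unhit
  \<open>v\<close> with \<open>x\<close> in \<open>N v\<close>.\<close>

lemma sum_gain:
  assumes "finite F"
  shows "(\<Sum>x\<in>F. gain D S x) = (\<Sum>v\<in>unhit D. real (card (N v \<inter> F)) * weight S v)"
proof -
  have "(\<Sum>x\<in>F. gain D S x) = (\<Sum>x\<in>F. \<Sum>v\<in>unhit D. if x \<in> N v then weight S v else 0)"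
    by (simp add: gain_def sum.inter_filter)
  also have "\<dots> = (\<Sum>v\<in>unhit D. \<Sum>x\<in>F. if x \<in> N v then weight S v else 0)"
    by (rule sum.swap)
  also have "\<dots> = (\<Sum>v\<in>unhit D. real (card (N v \<inter> F)) * weight S v)"
  proof (rule sum.cong)
    fix v
    have "{x \<in> F. x \<in> N v} = N v \<inter> F" by auto
    then show "(\<Sum>x\<in>F. if x \<in> N v then weight S v else 0) = real (card (N v \<inter> F)) * weight S v"
      using assms by (simp flip: sum.inter_filter)
  qed simp
  finally show ?thesis .
qed

text \<open>An unhit \<open>N v\<close> loses vertices only to Staller. A single weight is at most
  the potential, so (3/2)^c is at most the number of vertices; taking logarithms bounds c by
  3d/10.\<close>

lemma card_free_ge:
  assumes "v \<in> unhit D" "potential D S \<le> card V"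
  shows "d / 2 \<le> card (N v \<inter> (V - (D \<union> S)))"
proof -
  define c where "c = card (N v \<inter> S)"
  have v: "v \<in> V" "N v \<inter> D = {}" using assms(1) by (auto simp: unhit_def)
  have "(3/2) ^ c \<le> real (card V)"
    using weight_le_potential[OF assms(1), of S] assms(2) by (simp add: weight_def c_def)
  then have "ln ((3/2) ^ c) \<le> ln (real (card V))"
    by (simp add: card_V_pos)
  then have "c * ln (3/2) \<le> d / 10"
    using ln_le_d by (simp add: ln_realpow)
  \<comment> \<open>Equivalent to e <= (3/2)^3 = 27/8, which follows from e <= 3.\<close>
  moreover have "1/3 \<le> ln (3/2 :: real)"
  proof -
    have "exp 1 \<le> (3/2 :: real) ^ 3"
      using exp_le by (simp add: power3_eq_cube)
    then have "ln (exp 1) \<le> ln ((3/2 :: real) ^ 3)"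
      by (subst ln_le_cancel_iff) auto
    then show ?thesis by (simp add: ln_realpow)
  qed
  then have "c * (1/3) \<le> c * ln (3/2 :: real)"
    by (intro mult_left_mono) auto
  ultimately have c: "c \<le> d / 2" by simp
  have "N v \<inter> (V - (D \<union> S)) = N v - N v \<inter> S"
    using v N_subset by blast
  then have "card (N v \<inter> (V - (D \<union> S))) = card (N v) - c"
    using finite_N[OF v(1)] by (simp add: c_def card_Diff_subset)
  then show ?thesis using c card_N[OF v(1)] by linarith
qed

text \<open>Averaging: the gains of the free vertices sum to at least d/2 times the potential, and
  there are at most \<open>card V\<close> of them.\<close>

lemma ex_best_vertex:
  assumes "unhit D \<noteq> {}" "potential D S \<le> card V" "d > 0"
  obtains x where "x \<in> V - (D \<union> S)" "\<And>y. y \<in> V - (D \<union> S) \<Longrightarrow> gain D S y \<le> gain D S x"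
    "d * potential D S \<le> 2 * card V * gain D S x"
proof -
  let ?F = "V - (D \<union> S)"
  have fin: "finite ?F" using finite_V by simp
  obtain v where "v \<in> unhit D" using assms(1) by blast
  then have "?F \<noteq> {}" using card_free_ge[OF _ assms(2)] assms(3) by fastforce
  then obtain x where "is_arg_min (\<lambda>y. - gain D S y) (\<lambda>y. y \<in> ?F) x"
    using ex_is_arg_min_if_finite[OF fin] by blast
  then have x: "x \<in> ?F" "\<And>y. y \<in> ?F \<Longrightarrow> gain D S y \<le> gain D S x"
    by (simp_all add: is_arg_min_linorder)
  have "d / 2 * potential D S \<le> (\<Sum>v\<in>unhit D. real (card (N v \<inter> ?F)) * weight S v)"
    unfolding potential_def sum_distrib_left
    using card_free_ge assms(2) by (intro sum_mono mult_right_mono) (auto simp: weight_nonneg)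
  also have "\<dots> = (\<Sum>y\<in>?F. gain D S y)"
    using fin by (simp add: sum_gain)
  also have "\<dots> \<le> real (card ?F) * gain D S x"
    using x(2) by (rule sum_bounded_above)
  also have "\<dots> \<le> real (card V) * gain D S x"
    using finite_V by (intro mult_right_mono) (auto simp: gain_nonneg card_mono)
  finally show ?thesis
    using that[OF x] by simp
qed

text \<open>A best vertex removes at least the fraction d/(2n) of the potential, n being
  \<open>card V\<close>; at least half of that survives Staller's reply.\<close>

definition rate :: real where
  "rate = 1 - d / (4 * card V)"

lemma rate_bounds: "0 \<le> rate" "rate \<le> 1"
proof -
  obtain v where v: "v \<in> V" using V_nonempty by blast
  have "d \<le> card V"
    using card_N[OF v] card_mono[OF finite_V N_subset[OF v]] by simp
  then show "0 \<le> rate" "rate \<le> 1"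
    using card_V_pos by (auto simp: rate_def field_simps)
qed

text \<open>Induction on the number of greedy claims. The base case is the last claim of the turn,
  the only one that must pay for Staller's reply. The bound before that reply is recorded as well,
  because it later guarantees that a free vertex remains for Staller.\<close>

lemma ex_good_turn:
  assumes "potential D S \<le> card V" "d > 0"
  shows "\<exists>X \<subseteq> V - (D \<union> S). card X \<le> Suc j \<and> potential (D \<union> X) S \<le> potential D S \<and>
    (\<forall>y \<in> V - (D \<union> X \<union> S). potential (D \<union> X) (insert y S) \<le> rate ^ Suc j * potential D S)"
  using assms(1)
proof (induction j arbitrary: D)
  case (0 D)
  show ?case
  proof (cases "unhit D = {}")
    case True
    then show ?thesis by (intro exI[of _ "{}"]) (simp add: potential_def)
  next
    case False
    then obtain x where x: "x \<in> V - (D \<union> S)"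
      "\<And>y. y \<in> V - (D \<union> S) \<Longrightarrow> gain D S y \<le> gain D S x"
      "d * potential D S \<le> 2 * card V * gain D S x"
      using ex_best_vertex[OF _ 0 assms(2)] by blast
    have "potential (insert x D) (insert y S) \<le> rate * potential D S"
      if y: "y \<in> V - (insert x D \<union> S)" for y
    proof -
      \<comment> \<open>\<open>y\<close> was free when \<open>x\<close> was chosen and gains only
        drop as \<open>D\<close> grows, so the reply gives back at most half of what
        \<open>x\<close> removed.\<close>
      have "gain (insert x D) S y \<le> gain D S x"
        using gain_antimono[of D "insert x D" S y] x(2)[of y] y by (auto intro: order_trans)
      then have "potential (insert x D) (insert y S) \<le> potential D S - gain D S x / 2"
        using y potential_insert_right[of y S "insert x D"] by (simp add: potential_insert_left)
      also have "\<dots> \<le> rate * potential D S"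
        using x(3) card_V_pos by (simp add: rate_def field_simps)
      finally show ?thesis .
    qed
    then show ?thesis
      using x(1) gain_nonneg by (intro exI[of _ "{x}"]) (auto simp: potential_insert_left)
  qed
next
  case (Suc j D)
  show ?case
  proof (cases "unhit D = {}")
    case True
    then show ?thesis by (intro exI[of _ "{}"]) (simp add: potential_def)
  next
    case False
    then obtain x where x: "x \<in> V - (D \<union> S)"
      "d * potential D S \<le> 2 * card V * gain D S x"
      using ex_best_vertex[OF _ Suc.prems assms(2)] by blast
    let ?D = "insert x D"
    have le: "potential ?D S \<le> potential D S"
      by (simp add: potential_insert_left gain_nonneg)
    \<comment> \<open>An unanswered claim removes twice as much as needed; half is discarded so that
      every claim has the same factor \<open>rate\<close>.\<close>
    have "0 \<le> card V * gain D S x"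
      by (simp add: gain_nonneg)
    then have "d * potential D S \<le> 4 * card V * gain D S x"
      using x(2) by linarith
    then have decr: "potential ?D S \<le> rate * potential D S"
      using card_V_pos by (simp add: potential_insert_left rate_def field_simps)
    obtain X where X: "X \<subseteq> V - (?D \<union> S)" "card X \<le> Suc j"
      "potential (?D \<union> X) S \<le> potential ?D S"
      "\<forall>y \<in> V - (?D \<union> X \<union> S). potential (?D \<union> X) (insert y S) \<le> rate ^ Suc j * potential ?D S"
      using Suc.IH[of ?D] le Suc.prems by auto
    have "rate ^ Suc j * potential ?D S \<le> rate ^ Suc j * (rate * potential D S)"
      using decr rate_bounds by (intro mult_left_mono) auto
    then have "rate ^ Suc j * potential ?D S \<le> rate ^ Suc (Suc j) * potential D S"
      by (simp add: mult_ac)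
    moreover have "card (insert x X) \<le> Suc (Suc j)"
      using X(2) card_insert_le_m1[of "Suc (Suc j)" X x] by simp
    moreover have "D \<union> insert x X = ?D \<union> X" by simp
    ultimately show ?thesis
      using X le x(1) by (intro exI[of _ "insert x X"]) (auto intro: order_trans)
  qed
qed

end

section \<open>Closed neighbourhoods in a graph\<close>

definition closed_nbhd :: "'a pair_pre_digraph \<Rightarrow> 'a \<Rightarrow> 'a set" where
  "closed_nbhd G v = insert v {u. (u, v) \<in> parcs G}"

lemma (in pair_graph) closed_nbhd_subset: "v \<in> pverts G \<Longrightarrow> closed_nbhd G v \<subseteq> pverts G"
  using in_arcsD1 by (auto simp: closed_nbhd_def)

text \<open>\<open>min_degree\<close> counts out-neighbours while \<open>closed_nbhd\<close>
  collects in-neighbours, as in \<open>dominating_set\<close>; symmetry of the arcs identifies the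
  two.\<close>

lemma (in pair_graph) min_degree_le_card_closed_nbhd:
  assumes "v \<in> pverts G"
  shows "min_degree G \<le> card (closed_nbhd G v)"
proof -
  have "min_degree G \<le> out_degree (with_proj G) v"
    unfolding min_degree_def using assms by (intro Min_le) auto
  also have "\<dots> = card {e \<in> parcs G. fst e = v}"
    by (simp add: out_degree_def out_arcs_def)
  also have "{e \<in> parcs G. fst e = v} = Pair v ` {u. (u, v) \<in> parcs G}"
    using arcs_symmetric by (auto simp: image_iff)
  also have "card \<dots> = card {u. (u, v) \<in> parcs G}"
    by (simp add: card_image inj_on_def)
  also have "\<dots> \<le> card (closed_nbhd G v)"
    using finite_subset[OF closed_nbhd_subset[OF assms]]
    by (intro card_mono) (auto simp: closed_nbhd_def)
  finally show ?thesis .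
qed

lemma (in pair_graph) contains_dominating_setI:
  assumes "\<And>v. v \<in> pverts G \<Longrightarrow> closed_nbhd G v \<inter> D \<noteq> {}"
  shows "contains_dominating_set G D"
  unfolding contains_dominating_set_def dominating_set_def
\<comment> \<open>\<open>D\<close> may contain elements outside the graph, so it is cut down to the
  vertices.\<close>
proof (intro exI[of _ "D \<inter> pverts G"] conjI ballI)
  fix v assume v: "v \<in> pverts G - D \<inter> pverts G"
  then obtain u where "u \<in> closed_nbhd G v" "u \<in> D" using assms by blast
  then show "\<exists>u\<in>D \<inter> pverts G. (u, v) \<in> parcs G"
    using v closed_nbhd_subset by (auto simp: closed_nbhd_def)
qed auto

section \<open>Dominator's strategy and the number of rounds\<close>

context
  fixes G :: "'a pair_pre_digraph"
  assumes G: "pair_graph G"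
    and V: "pverts G \<noteq> {}"
    and deg: "10 * ln (real (card (pverts G))) \<le> real (min_degree G)"
    and pos: "0 < min_degree G"
begin

interpretation pair_graph G by (rule G)

interpretation hitting_game "pverts G" "closed_nbhd G" "min_degree G"
  using closed_nbhd_subset min_degree_le_card_closed_nbhd deg V by unfold_locales auto

lemma wins_if_unhit_empty: "unhit D = {} \<Longrightarrow> contains_dominating_set G D"
  by (rule contains_dominating_setI) (auto simp: unhit_def)

text \<open>One round multiplies the potential by at most \<open>rate ^ b\<close>, so both bounds
  pass on to the next round: the first keeps good vertices available, the second controls the
  potential left after all rounds.\<close>

lemma wins_within_if_potential:
  assumes "potential D S \<le> card (pverts G)" "rate ^ (b * k) * potential D S < 1" "b > 0"
  shows "dominator_wins_within G b k D S"
  using assms(1,2)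
proof (induction k arbitrary: D S)
  case 0
  then show ?case by (simp add: potential_less_1_iff wins_if_unhit_empty)
next
  case (Suc k)
  have b: "Suc (b - 1) = b" using assms(3) by simp
  obtain X where X: "X \<subseteq> pverts G - (D \<union> S)" "card X \<le> b"
    "potential (D \<union> X) S \<le> potential D S"
    "\<forall>y \<in> pverts G - (D \<union> X \<union> S).
       potential (D \<union> X) (insert y S) \<le> rate ^ b * potential D S"
    using ex_good_turn[OF Suc.prems(1) pos, of "b - 1"] unfolding b by (elim exE conjE)
  show ?case
  proof (cases "unhit (D \<union> X) = {}")
    case True
    then show ?thesis
      using X(1,2) wins_if_unhit_empty[OF True]
      unfolding dominator_wins_within.simps by (intro exI[of _ X] conjI disjI1)
  next
    case False
    \<comment> \<open>Without a free vertex for Staller, an unfinished game is lost for Dominator.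
      As something is still unhit, a best vertex exists, and in particular a free one.\<close>
    have "potential (D \<union> X) S \<le> card (pverts G)" using X(3) Suc.prems(1) by linarith
    from ex_best_vertex[OF False this pos]
    obtain x where "x \<in> pverts G - (D \<union> X \<union> S)" .
    then have "pverts G - (D \<union> X \<union> S) \<noteq> {}" by blast
    moreover have "dominator_wins_within G b k (D \<union> X) (insert y S)"
      if y: "y \<in> pverts G - (D \<union> X \<union> S)" for y
    proof (rule Suc.IH)
      have le: "potential (D \<union> X) (insert y S) \<le> rate ^ b * potential D S"
        using X(4) y by blast
      also have "\<dots> \<le> potential D S"
        using rate_bounds potential_nonneg by (simp add: mult_left_le_one_le power_le_one)
      finally show "potential (D \<union> X) (insert y S) \<le> card (pverts G)"
        using Suc.prems(1) by linarith
      have "rate ^ (b * k) * potential (D \<union> X) (insert y S)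
          \<le> rate ^ (b * k) * (rate ^ b * potential D S)"
        using le rate_bounds by (intro mult_left_mono) auto
      also have "\<dots> = rate ^ (b * Suc k) * potential D S"
        by (simp add: power_add mult_ac)
      finally show "rate ^ (b * k) * potential (D \<union> X) (insert y S) < 1"
        using Suc.prems(2) by linarith
    qed
    ultimately show ?thesis
      using X(1,2) unfolding dominator_wins_within.simps
      by (intro exI[of _ X] conjI disjI2 ballI)
  qed
qed

text \<open>As 1 - t <= exp(-t), the factor for bk claims is at most exp(-tbk) with t = d/(4n); the
  first hypothesis makes this less than 1/n, and the initial potential is n.\<close>

lemma wins_within_if_many_rounds:
  assumes "4 * card (pverts G) * ln (card (pverts G)) < min_degree G * real (b * k)" "b > 0"
  shows "dominator_wins_within G b k {} {}"
proof (rule wins_within_if_potential)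
  let ?n = "real (card (pverts G))"
  define t where "t = min_degree G / (4 * ?n)"
  have n: "?n > 0" using card_V_pos by simp
  have "rate \<le> exp (- t)"
    using exp_ge_add_one_self[of "- t"] by (simp add: rate_def t_def)
  then have "rate ^ (b * k) \<le> exp (- t) ^ (b * k)"
    using rate_bounds by (intro power_mono)
  also have "\<dots> = exp (- (t * real (b * k)))"
    by (simp add: mult_ac flip: exp_of_nat_mult)
  also have "\<dots> < exp (- ln ?n)"
    using assms(1) n by (simp add: t_def field_simps)
  also have "\<dots> = 1 / ?n"
    using n by (simp add: exp_minus inverse_eq_divide)
  finally show "rate ^ (b * k) * potential {} {} < 1"
    using n by (simp add: potential_empty field_simps)
qed (use assms in \<open>auto simp: potential_empty\<close>)

end

theorem theorem1p9:
  fixes G :: "'a pair_pre_digraph" and n b :: nat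
  assumes "pair_graph G"
    and "n = card (pverts G)"
    and "n \<ge> 2"
    and "real (min_degree G) \<ge> 10 * ln (real n)"
    and "b \<ge> 1"
  shows "ereal_of_enat (gamma_MB G b)
           \<le> ereal (max 1 (10 * real n * ln (real n) / (real b * real (min_degree G))))"
proof -
  define T where "T = 10 * real n * ln (real n) / (real b * real (min_degree G))"
  \<comment> \<open>Rounding down keeps \<open>k\<close> within the claimed bound. Together with the
    maximum it costs at most a factor of 2, so the constant 10 becomes 5, still above the 4 that
    \<open>wins_within_if_many_rounds\<close> needs.\<close>
  define k where "k = max 1 (nat \<lfloor>T\<rfloor>)"
  have ln: "ln (real n) > 0" using assms(3) by simp
  then have d: "min_degree G > 0" using assms(4) by simp
  have T: "T \<ge> 0" using ln by (simp add: T_def)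
  then have k: "real k \<le> max 1 T" "T / 2 \<le> real k"
    by (auto simp: k_def) linarith+
  have "4 * real n * ln (real n) < 5 * real n * ln (real n)"
    using ln assms(3) by simp
  also have "\<dots> = min_degree G * (b * (T / 2))"
    using d assms(5) by (simp add: T_def)
  also have "\<dots> \<le> min_degree G * (b * real k)"
    using k(2) by (intro mult_left_mono) auto
  finally have "dominator_wins_within G b k {} {}"
    using assms d by (intro wins_within_if_many_rounds) auto
  then have "gamma_MB G b \<le> enat k"
    unfolding gamma_MB_def by (intro Inf_lower) blast
  then have "ereal_of_enat (gamma_MB G b) \<le> ereal_of_enat (enat k)"
    by (simp only: ereal_of_enat_le_iff)
  also have "\<dots> \<le> ereal (max 1 T)"
    using k(1) by (simp only: ereal_of_enat_simps ereal_less_eq)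
  finally show ?thesis unfolding T_def .
qed

end
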